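(* As $k$ ranges over the positive integers, $$f(\mathbb{N}_k)=\int_1^\infty P_k(s)\,ds\ \le\ 1+O\big(k\,2^{-k/2}\big),$$ where the implied constant is absolute; that is, the displayed equality holds for every $k\ge1$ and there is an absolute constant $C>0$ such that $f(\mathbb{N}_k)\le 1+C\,k\,2^{-k/2}$ for all $k\ge 1$.
   Context: For a positive integer $n$, $\Omega(n)$ denotes the number of prime factors of $n$ counted with multiplicity. For each integer $k\ge 1$, $\mathbb{N}_k=\{n\ge 1:\Omega(n)=k\}$ is the set of $k$-almost primes, $f(\mathbb{N}_k):=\sum_{\Omega(n)=k}\frac{1}{n\log n}$, and $P_k(s):=\sum_{\Omega(n)=k}n^{-s}$ for real $s>1$. *)

theory Defs
  imports "HOL-Analysis.Analysis" "HOL-Computational_Algebra.Primes"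
begin

definition bigomega :: "nat \<Rightarrow> nat" where
  "bigomega n = size (prime_factorization n)"

definition almost_primes :: "nat \<Rightarrow> nat set" where
  "almost_primes k = {n. n \<ge> 1 \<and> bigomega n = k}"

(* The term at n = 1 would be 1 / 0 = 0; for k \<ge> 1 the set almost_primes k does not contain 1. *)
definition erdos_sum :: "nat set \<Rightarrow> real" where
  "erdos_sum A = (\<Sum>\<^sub>\<infinity>n\<in>A. 1 / (real n * ln (real n)))"

(* Meaningful for s > 1 only: infsum returns 0 where the series diverges. *)
definition almost_prime_zeta :: "nat \<Rightarrow> real \<Rightarrow> real" where
  "almost_prime_zeta k s = (\<Sum>\<^sub>\<infinity>n\<in>almost_primes k. real n powr (- s))"

end

theory Submission
  imports Defs "HOL-Probability.Distributions"
begin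

text \<open>
  Fix a finite set \<open>S\<close> of primes and write \<open>P(s)\<close> for the sum of \<open>p powr - s\<close> over \<open>S\<close>. The almost
  primes composed of primes in \<open>S\<close> have the generating function
  \<open>\<Prod>p\<in>S. 1 / (1 - p powr - s * X) = exp (P(s) * X) * Q(s, X)\<close>, where
  \<open>Q(s, X) = \<Prod>p\<in>S. exp (- p powr - s * X) / (1 - p powr - s * X)\<close> has nonnegative coefficients that
  decrease in \<open>s\<close>, so \<open>Q(s, X)\<close> may be replaced by \<open>Q(1, X)\<close>, whose radius of convergence is at least 2
  uniformly in \<open>S\<close>. With \<open>exp c = Q(1, 1)\<close>, the bound \<open>s / (s - 1)\<close> for the Euler product gives
  \<open>P(s) \<le> - ln (s - 1) - c + K * (s - 1)\<close>. Substituting \<open>s = 1 + exp (- c - v)\<close>, the integral of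
  \<open>P(s) ^ i / fact i\<close> over \<open>v \<ge> 0\<close> is at most \<open>exp (- c) * (1 + O(2 ^ -i))\<close> by the Gamma integral, and
  convolving with the coefficients of \<open>Q(1, X)\<close>, whose sum is at most \<open>exp c\<close>, gives
  \<open>1 + O(2 powr - (k / 2))\<close>. The remaining range of \<open>s\<close> contributes only to the error term. All
  constants are independent of \<open>S\<close>, and the integral formula follows by monotone convergence.
\<close>

subsection \<open>Power series with nonnegative coefficients\<close>

definition fps_geo :: "real \<Rightarrow> real fps" where
  "fps_geo x = Abs_fps (\<lambda>n. x ^ n)"

text \<open>The coefficient of \<open>X ^ n\<close> is \<open>x ^ n\<close> times the proportion of derangements among the
  permutations of \<open>n\<close> points; this is why it is nonnegative and increasing in \<open>x\<close>.\<close>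

definition fps_derange :: "real \<Rightarrow> real fps" where
  "fps_derange x = fps_exp (- x) * fps_geo x"

lemma fps_geo_nth [simp]: "fps_nth (fps_geo x) n = x ^ n"
  by (simp add: fps_geo_def)

lemma fps_mult_nth_le: "fps_nth (F * G) n = (\<Sum>i\<le>n. fps_nth F i * fps_nth G (n - i))"
  by (simp add: fps_mult_nth atLeast0AtMost)

text \<open>The terms do not grow in absolute value. Up to an odd index the sum starts from 1 - 1 =
  0 and gains nonnegative pairs; a nonzero even index adds one more positive term.\<close>

lemma sum_alternating_inverse_fact_nonneg: "0 \<le> (\<Sum>i\<le>n. (-1) ^ i / fact i :: real)"
proof -
  let ?d = "\<lambda>n. \<Sum>i\<le>n. (-1) ^ i / fact i :: real"
  have odd: "0 \<le> ?d (2 * m + 1)" for m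
  proof (induction m)
    case (Suc m)
    let ?n = "2 * m + 1"
    have "?d (Suc (Suc ?n)) = ?d ?n + (1 / fact (Suc ?n) - 1 / fact (Suc (Suc ?n)))"
      by (simp add: minus_one_power_iff del: fact_Suc)
    moreover have "1 / fact (Suc (Suc ?n)) \<le> (1 / fact (Suc ?n) :: real)"
      by (intro divide_left_mono fact_mono mult_pos_pos) auto
    moreover have "2 * Suc m + 1 = Suc (Suc ?n)" by simp
    ultimately show ?case using Suc by (simp only:)
  qed simp
  show ?thesis
  proof (cases "even n")
    case True
    show ?thesis
    proof (cases "n = 0")
      case False
      with True obtain m where n: "n = Suc (2 * m + 1)"
        by (metis add_2_eq_Suc' dvdE mult_Suc_right not0_implies_Suc mult_0_right add.commute Suc_eq_plus1)
      have "?d n = ?d (2 * m + 1) + 1 / fact n"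
        unfolding n by (simp add: minus_one_power_iff del: fact_Suc)
      with odd[of m] show ?thesis by (smt (verit) divide_nonneg_nonneg fact_ge_zero)
    qed simp
  next
    case False
    then show ?thesis using odd by (auto elim: oddE)
  qed
qed

lemma fps_derange_nth:
  "fps_nth (fps_derange x) n = x ^ n * (\<Sum>i\<le>n. (-1) ^ i / fact i)"
proof -
  have "fps_nth (fps_derange x) n = (\<Sum>i\<le>n. (- x) ^ i / fact i * x ^ (n - i))"
    by (simp add: fps_derange_def fps_mult_nth_le)
  also have "\<dots> = (\<Sum>i\<le>n. x ^ n * ((-1) ^ i / fact i))"
  proof (intro sum.cong refl)
    fix i assume "i \<in> {..n}"
    then have "x ^ n = x ^ i * x ^ (n - i)" by (simp flip: power_add)
    then show "(- x) ^ i / fact i * x ^ (n - i) = x ^ n * ((-1) ^ i / fact i)"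
      by (simp add: power_minus[of x])
  qed
  finally show ?thesis by (simp add: sum_distrib_left)
qed

lemma fps_derange_nonneg: "0 \<le> x \<Longrightarrow> 0 \<le> fps_nth (fps_derange x) n"
  by (simp add: fps_derange_nth sum_alternating_inverse_fact_nonneg)

lemma fps_derange_mono:
  "0 \<le> x \<Longrightarrow> x \<le> y \<Longrightarrow> fps_nth (fps_derange x) n \<le> fps_nth (fps_derange y) n"
  unfolding fps_derange_nth
  by (intro mult_right_mono power_mono sum_alternating_inverse_fact_nonneg)

lemma fps_prod_nonneg:
  fixes F :: "'a \<Rightarrow> real fps"
  assumes "\<And>p j. p \<in> S \<Longrightarrow> 0 \<le> fps_nth (F p) j"
  shows "0 \<le> fps_nth (\<Prod>p\<in>S. F p) n"
  using assms
proof (induction S arbitrary: n rule: infinite_finite_induct)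
  case (insert p S)
  then show ?case by (auto simp: fps_mult_nth intro!: sum_nonneg mult_nonneg_nonneg)
qed auto

text \<open>Convolution of nonnegative sequences is monotone in both factors; this allows
  \<open>Q(s, X)\<close> to be replaced by \<open>Q(1, X)\<close> coefficientwise.\<close>

lemma fps_prod_mono:
  fixes F G :: "'a \<Rightarrow> real fps"
  assumes "\<And>p j. p \<in> S \<Longrightarrow> 0 \<le> fps_nth (F p) j"
    and "\<And>p j. p \<in> S \<Longrightarrow> fps_nth (F p) j \<le> fps_nth (G p) j"
  shows "fps_nth (\<Prod>p\<in>S. F p) n \<le> fps_nth (\<Prod>p\<in>S. G p) n"
  using assms
proof (induction S arbitrary: n rule: infinite_finite_induct)
  case (insert p S)
  have "0 \<le> fps_nth (\<Prod>p\<in>S. F p) j" for j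
    using insert.prems by (intro fps_prod_nonneg) auto
  moreover have "0 \<le> fps_nth (G p) j" for j
    using insert.prems by (meson insertI1 order_trans)
  ultimately show ?case using insert
    by (auto simp: fps_mult_nth intro!: sum_mono mult_mono)
qed auto

lemma fps_mult_sums:
  fixes F G :: "real fps"
  assumes "summable (\<lambda>n. norm (fps_nth F n * r ^ n))" "(\<lambda>n. fps_nth F n * r ^ n) sums a"
    and "summable (\<lambda>n. norm (fps_nth G n * r ^ n))" "(\<lambda>n. fps_nth G n * r ^ n) sums b"
  shows "(\<lambda>n. fps_nth (F * G) n * r ^ n) sums (a * b)"
proof -
  have "(\<lambda>n. \<Sum>i\<le>n. (fps_nth F i * r ^ i) * (fps_nth G (n - i) * r ^ (n - i))) sums (a * b)"
    using Cauchy_product_sums[OF assms(1,3)] assms(2,4) by (simp add: sums_iff)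
  moreover have "(\<Sum>i\<le>n. (fps_nth F i * r ^ i) * (fps_nth G (n - i) * r ^ (n - i)))
      = fps_nth (F * G) n * r ^ n" for n
  proof -
    have "(fps_nth F i * r ^ i) * (fps_nth G (n - i) * r ^ (n - i))
        = fps_nth F i * fps_nth G (n - i) * r ^ n" if "i \<le> n" for i
      using that by (simp add: mult_ac flip: power_add)
    then show ?thesis
      unfolding fps_mult_nth_le sum_distrib_right by (intro sum.cong) auto
  qed
  ultimately show ?thesis by simp
qed

text \<open>Nonnegative coefficients and r \<ge> 0 make convergence absolute, so the Cauchy product
  theorem applies at each step.\<close>

lemma fps_prod_sums:
  fixes F :: "'a \<Rightarrow> real fps"
  assumes "finite S" and "0 \<le> r" and "\<And>p j. p \<in> S \<Longrightarrow> 0 \<le> fps_nth (F p) j"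
    and "\<And>p. p \<in> S \<Longrightarrow> (\<lambda>n. fps_nth (F p) n * r ^ n) sums a p"
  shows "(\<lambda>n. fps_nth (\<Prod>p\<in>S. F p) n * r ^ n) sums (\<Prod>p\<in>S. a p)"
  using assms
proof (induction S rule: finite_induct)
  case empty
  have "(\<lambda>n. fps_nth (1 :: real fps) n * r ^ n) sums (\<Sum>n\<in>{0}. fps_nth (1 :: real fps) n * r ^ n)"
    by (rule sums_finite) auto
  then show ?case by simp
next
  case (insert p S)
  have nn: "0 \<le> fps_nth (\<Prod>p\<in>S. F p) j" for j
    using insert.prems by (intro fps_prod_nonneg) auto
  have IH: "(\<lambda>n. fps_nth (\<Prod>p\<in>S. F p) n * r ^ n) sums (\<Prod>p\<in>S. a p)"
    using insert by auto
  have p: "(\<lambda>n. fps_nth (F p) n * r ^ n) sums a p" using insert by auto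
  have "(\<lambda>n. fps_nth (F p * (\<Prod>p\<in>S. F p)) n * r ^ n) sums (a p * (\<Prod>p\<in>S. a p))"
  proof (rule fps_mult_sums)
    show "summable (\<lambda>n. norm (fps_nth (F p) n * r ^ n))"
      using p insert.prems by (simp add: abs_mult sums_iff)
    show "summable (\<lambda>n. norm (fps_nth (\<Prod>p\<in>S. F p) n * r ^ n))"
      using IH nn insert.prems by (simp add: abs_mult sums_iff)
  qed (use p IH in auto)
  then show ?case using insert.hyps by simp
qed

lemma fps_geo_sums:
  assumes "0 \<le> x" "0 \<le> r" "r * x < 1"
  shows "(\<lambda>n. fps_nth (fps_geo x) n * r ^ n) sums (1 / (1 - r * x))"
proof -
  have "(\<lambda>n. (r * x) ^ n) sums (1 / (1 - r * x))"
    using assms by (intro geometric_sums) auto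
  then show ?thesis by (simp add: power_mult_distrib mult.commute)
qed

lemma fps_exp_sums: "(\<lambda>n. fps_nth (fps_exp x) n * r ^ n) sums exp (r * x :: real)"
  using exp_converges[of "r * x"] by (simp add: power_mult_distrib field_simps scaleR_conv_of_real)

lemma fps_derange_sums:
  assumes "0 \<le> x" "0 \<le> r" "r * x < 1"
  shows "(\<lambda>n. fps_nth (fps_derange x) n * r ^ n) sums (exp (- (r * x)) / (1 - r * x))"
proof -
  have "(\<lambda>n. fps_nth (fps_exp (- x) * fps_geo x) n * r ^ n)
      sums (exp (r * - x) * (1 / (1 - r * x)))"
  proof (rule fps_mult_sums)
    have "summable (\<lambda>n. norm ((r * - x) ^ n /\<^sub>R fact n))"
      by (rule summable_norm_exp)
    then show "summable (\<lambda>n. norm (fps_nth (fps_exp (- x)) n * r ^ n))"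
      by (simp add: power_mult_distrib field_simps abs_mult power_abs)
    show "summable (\<lambda>n. norm (fps_nth (fps_geo x) n * r ^ n))"
      using fps_geo_sums[OF assms] assms by (simp add: sums_iff abs_mult)
  qed (rule fps_exp_sums fps_geo_sums assms)+
  then show ?thesis by (simp add: fps_derange_def)
qed

lemma fps_exp_uminus_mult: "fps_exp x * fps_exp (- x) = (1 :: real fps)"
  using fps_exp_add_mult[of x "- x"] by simp

lemma fps_exp_sum: "fps_exp (\<Sum>p\<in>S. x p :: real) = (\<Prod>p\<in>S. fps_exp (x p))"
  by (induction S rule: infinite_finite_induct) (auto simp: fps_exp_add_mult)

text \<open>The exponential inside each derangement series cancels, and the compensating
  exponentials merge into one.\<close>

lemma prod_fps_geo:
  "(\<Prod>p\<in>S. fps_geo (x p)) = fps_exp (\<Sum>p\<in>S. x p) * (\<Prod>p\<in>S. fps_derange (x p))"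
  unfolding fps_exp_sum fps_derange_def prod.distrib[symmetric] mult.assoc[symmetric]
    fps_exp_uminus_mult by simp

subsection \<open>Almost primes over a finite set of primes\<close>

definition almost_primes_over :: "nat set \<Rightarrow> nat \<Rightarrow> nat set" where
  "almost_primes_over S k = {n \<in> almost_primes k. prime_factors n \<subseteq> S}"

lemma almost_primes_ge_2: "1 \<le> k \<Longrightarrow> n \<in> almost_primes k \<Longrightarrow> 2 \<le> n"
  by (cases "n = 1") (auto simp: almost_primes_def bigomega_def)

lemma bigomega_eq_0: "n \<ge> 1 \<Longrightarrow> bigomega n = 0 \<longleftrightarrow> n = 1"
  by (auto simp: bigomega_def prime_factorization_empty_iff)

lemma almost_primes_over_0: "almost_primes_over S 0 = {1}"
  by (auto simp: almost_primes_over_def almost_primes_def bigomega_eq_0)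

lemma almost_primes_over_empty: "almost_primes_over {} (Suc k) = {}"
proof -
  have "n = 1" if "n \<ge> 1" "prime_factors n = {}" for n :: nat
    using that by (auto simp: prime_factorization_empty_iff)
  then show ?thesis by (fastforce simp: almost_primes_over_def almost_primes_def bigomega_def)
qed

text \<open>Case split on whether p divides n. The quotient n / p may still contain p, hence
  \<open>insert p S\<close> in the image.\<close>

lemma almost_primes_over_insert:
  assumes p: "prime p" "p \<notin> S"
  shows "almost_primes_over (insert p S) (Suc k) =
    almost_primes_over S (Suc k) \<union> (*) p ` almost_primes_over (insert p S) k" (is "?L = ?R1 \<union> ?R2")
    and "almost_primes_over S (Suc k) \<inter> (*) p ` almost_primes_over (insert p S) k = {}"
proof -
  have pf: "prime_factorization (p * m) = add_mset p (prime_factorization m)" if "m \<ge> 1" for m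
    using p that by (simp add: prime_factorization_mult prime_factorization_prime)
  show "?L = ?R1 \<union> ?R2"
  proof (intro equalityI subsetI)
    fix n assume n: "n \<in> ?L"
    show "n \<in> ?R1 \<union> ?R2"
    proof (cases "p dvd n")
      case True
      then obtain m where m: "n = p * m" by auto
      with n have "m \<ge> 1" by (auto simp: almost_primes_over_def almost_primes_def)
      with n pf[of m] m have "m \<in> almost_primes_over (insert p S) k"
        by (auto simp: almost_primes_over_def almost_primes_def bigomega_def)
      with m show ?thesis by auto
    next
      case False
      then have "p \<notin> prime_factors n" by auto
      with n show ?thesis by (auto simp: almost_primes_over_def)
    qed
  next
    fix n assume "n \<in> ?R1 \<union> ?R2"
    then show "n \<in> ?L"
    proof
      assume "n \<in> ?R2"
      then obtain m where m: "m \<in> almost_primes_over (insert p S) k" "n = p * m" by auto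
      then have "m \<ge> 1" by (auto simp: almost_primes_over_def almost_primes_def)
      with m pf[of m] p show ?thesis
        by (auto simp: almost_primes_over_def almost_primes_def bigomega_def prime_gt_0_nat Suc_leI)
    qed (auto simp: almost_primes_over_def)
  qed
  show "?R1 \<inter> ?R2 = {}"
    using pf p by (fastforce simp: almost_primes_over_def almost_primes_def)
qed

lemma finite_almost_primes_over:
  assumes "finite S" "\<And>p. p \<in> S \<Longrightarrow> prime p"
  shows "finite (almost_primes_over S k)"
  using assms
proof (induction S arbitrary: k rule: finite_induct)
  case empty
  then show ?case by (cases k) (auto simp: almost_primes_over_0 almost_primes_over_empty)
next
  case (insert p S)
  show ?case
  proof (induction k)
    case (Suc k)
    then show ?case
      using insert almost_primes_over_insert(1)[of p S k] by auto
  qed (simp add: almost_primes_over_0)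
qed

text \<open>Unique factorization, by induction on S and, inside it, on k.\<close>

lemma sum_almost_primes_over:
  fixes s :: real
  assumes "finite S" "\<And>p. p \<in> S \<Longrightarrow> prime p"
  shows "(\<Sum>n\<in>almost_primes_over S k. real n powr - s)
    = fps_nth (\<Prod>p\<in>S. fps_geo (real p powr - s)) k"
  using assms
proof (induction S arbitrary: k rule: finite_induct)
  case empty
  then show ?case by (cases k) (auto simp: almost_primes_over_0 almost_primes_over_empty)
next
  case (insert p S)
  have fin: "finite (almost_primes_over T k)" if "T \<subseteq> insert p S" for T k
    using that insert.prems insert.hyps
    by (intro finite_almost_primes_over) (auto dest: finite_subset)
  let ?x = "real p powr - s"
  let ?G = "\<Prod>q\<in>S. fps_geo (real q powr - s)"
  have prime: "prime p" using insert by auto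
  \<comment> \<open>Coefficient form of H = G + x X H for H = G / (1 - x X); it mirrors the split of
    \<open>almost_primes_over_insert\<close>.\<close>
  have step: "fps_nth (fps_geo ?x * ?G) (Suc k) = fps_nth ?G (Suc k) + ?x * fps_nth (fps_geo ?x * ?G) k" for k
    by (simp add: fps_mult_nth sum.atLeast0_atMost_Suc_shift sum_distrib_left mult_ac
        del: sum.cl_ivl_Suc)
  have "(\<Sum>n\<in>almost_primes_over (insert p S) k. real n powr - s) = fps_nth (fps_geo ?x * ?G) k"
  proof (induction k)
    case 0
    have "fps_nth ?G 0 = 1"
      using insert.IH[of 0] insert.prems by (simp add: almost_primes_over_0)
    then show ?case by (simp add: almost_primes_over_0)
  next
    case (Suc k)
    have "(\<Sum>n\<in>almost_primes_over (insert p S) (Suc k). real n powr - s)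
        = (\<Sum>n\<in>almost_primes_over S (Suc k). real n powr - s)
        + (\<Sum>n\<in>(*) p ` almost_primes_over (insert p S) k. real n powr - s)"
      unfolding almost_primes_over_insert(1)[OF prime insert.hyps(2)]
      by (rule sum.union_disjoint)
        (use almost_primes_over_insert(2)[OF prime insert.hyps(2)] fin[of S] fin[of "insert p S"]
          insert.hyps in auto)
    also have "(\<Sum>n\<in>(*) p ` almost_primes_over (insert p S) k. real n powr - s)
        = (\<Sum>n\<in>almost_primes_over (insert p S) k. ?x * real n powr - s)"
      using prime by (subst sum.reindex) (auto simp: powr_mult inj_on_def)
    finally show ?case
      using Suc insert step[of k] by (simp flip: sum_distrib_left)
  qed
  then show ?case using insert.hyps by simp
qed

subsection \<open>Euler products\<close>

lemma sum_powr_le: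
  fixes s :: real
  assumes s: "1 < s" and A: "finite A" "\<And>n. n \<in> A \<Longrightarrow> n \<ge> 1"
  shows "(\<Sum>n\<in>A. real n powr - s) \<le> s / (s - 1)"
proof -
  have step: "real (Suc n) powr - s \<le> (real n powr (1 - s) - real (Suc n) powr (1 - s)) / (s - 1)"
    if "n \<ge> 1" for n :: nat
  proof -
    have "\<exists>z. real n < z \<and> z < real (Suc n) \<and> real (Suc n) powr (1 - s) - real n powr (1 - s)
        = (real (Suc n) - real n) * ((1 - s) * z powr (1 - s - 1))"
      using that by (intro MVT2) (auto intro!: derivative_eq_intros)
    then obtain z where z: "real n < z" "z < real (Suc n)"
      and eq: "real n powr (1 - s) - real (Suc n) powr (1 - s) = (s - 1) * z powr - s"
      by (auto simp: algebra_simps)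
    have "real (Suc n) powr - s \<le> z powr - s"
      using z that s by (intro powr_mono2') auto
    then have "(s - 1) * real (Suc n) powr - s \<le> real n powr (1 - s) - real (Suc n) powr (1 - s)"
      unfolding eq using s by (intro mult_left_mono) auto
    then show ?thesis using s by (simp add: pos_le_divide_eq mult.commute)
  qed
  \<comment> \<open>The subtracted term is the integral of x powr - s beyond Suc N; carrying it
    along makes the induction telescope, with equality at N = 0.\<close>
  have partial: "(\<Sum>n=1..Suc N. real n powr - s) \<le> s / (s - 1) - real (Suc N) powr (1 - s) / (s - 1)" for N
  proof (induction N)
    case 0
    show ?case using s by (simp flip: diff_divide_distrib)
  next
    case (Suc N)
    show ?case
      using Suc step[of "Suc N"] by (simp add: diff_divide_distrib)
  qed
  have "A \<subseteq> {1..Suc (Max A)}"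
    using A by (auto simp: le_Suc_eq)
  then have "(\<Sum>n\<in>A. real n powr - s) \<le> (\<Sum>n=1..Suc (Max A). real n powr - s)"
    by (intro sum_mono2) auto
  also have "\<dots> \<le> s / (s - 1)"
    using partial[of "Max A"] s by (smt (verit) divide_nonneg_pos powr_ge_zero)
  finally show ?thesis .
qed

text \<open>At X = 1 the generating function equals the product. Sets for distinct k are disjoint,
  so its partial sums run over finite sets of positive integers.\<close>

lemma euler_product_le:
  fixes s :: real
  assumes S: "finite S" "\<And>p. p \<in> S \<Longrightarrow> prime p" and s: "1 < s"
  shows "(\<Prod>p\<in>S. 1 / (1 - real p powr - s)) \<le> s / (s - 1)"
proof -
  have small: "real p powr - s < 1" if "p \<in> S" for p
    using prime_gt_1_nat[OF S(2)[OF that]] s by (simp add: powr_less_one)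
  have "(\<lambda>k. fps_nth (\<Prod>p\<in>S. fps_geo (real p powr - s)) k * 1 ^ k)
      sums (\<Prod>p\<in>S. 1 / (1 - 1 * real p powr - s))"
    by (rule fps_prod_sums[OF S(1)], simp, simp, rule fps_geo_sums) (use small in auto)
  then have sums: "(\<lambda>k. \<Sum>n\<in>almost_primes_over S k. real n powr - s)
      sums (\<Prod>p\<in>S. 1 / (1 - real p powr - s))"
    using sum_almost_primes_over[OF S] by simp
  have "(\<Sum>k<N. \<Sum>n\<in>almost_primes_over S k. real n powr - s) \<le> s / (s - 1)" for N
  proof -
    have "(\<Sum>k<N. \<Sum>n\<in>almost_primes_over S k. real n powr - s)
        = (\<Sum>n\<in>(\<Union>k<N. almost_primes_over S k). real n powr - s)"
      using finite_almost_primes_over[OF S]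
      by (subst sum.UNION_disjoint) (auto simp: almost_primes_over_def almost_primes_def)
    also have "\<dots> \<le> s / (s - 1)"
      using finite_almost_primes_over[OF S] s
      by (intro sum_powr_le) (auto simp: almost_primes_over_def almost_primes_def)
    finally show ?thesis .
  qed
  then show ?thesis
    using sums suminf_le_const[of "\<lambda>k. \<Sum>n\<in>almost_primes_over S k. real n powr - s"]
    by (simp add: sums_iff)
qed

section \<open>Logarithms of Euler factors beyond first order: the sum of x^j / j over j \<ge>
  2\<close>

definition log_excess :: "real \<Rightarrow> real" where
  "log_excess x = - ln (1 - x) - x"

lemma exp_log_excess: "x < 1 \<Longrightarrow> exp (log_excess x) = exp (- x) / (1 - x)"
  by (simp add: log_excess_def exp_diff exp_minus field_simps)

text \<open>The derivative t / (1 - t) is at most x / (1 - x) on [y, x]; the inequality ln t \<le> t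
  - 1 gives the same bound directly.\<close>

lemma log_excess_diff_le:
  assumes "0 \<le> y" "y \<le> x" "x < 1"
  shows "log_excess x - log_excess y \<le> x * (x - y) / (1 - x)"
proof -
  have "ln ((1 - y) / (1 - x)) \<le> (1 - y) / (1 - x) - 1"
    using assms by (intro ln_le_minus_one) auto
  then show ?thesis
    using assms by (simp add: log_excess_def ln_div field_simps)
qed

lemma log_excess_0 [simp]: "log_excess 0 = 0"
  by (simp add: log_excess_def)

lemma log_excess_nonneg: "x < 1 \<Longrightarrow> 0 \<le> log_excess x"
  unfolding log_excess_def using ln_le_minus_one[of "1 - x"] by simp

section \<open>Absolute constants and the sum of p powr - s over a finite set of primes\<close>

lemma summable_inverse_square: "summable (\<lambda>n. 1 / real n ^ 2)"
  using inverse_power_summable[of 2, where 'a=real] by (simp add: inverse_eq_divide)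

lemma ln_of_nat_nonneg: "0 \<le> ln (real n)"
  by (cases n) auto

lemma summable_ln_over_square: "summable (\<lambda>n. ln (real n) / real n ^ 2)"
proof (rule summable_comparison_test')
  show "summable (\<lambda>n. 2 * real n powr - (3/2))"
    using summable_real_powr_iff[of "- (3/2)"] by (intro summable_mult) simp
next
  fix n :: nat assume n: "1 \<le> n"
  have "ln (real n) \<le> real n powr (1/2) / (1/2)"
    using n by (intro ln_powr_bound) auto
  then have "ln (real n) / real n ^ 2 \<le> 2 * real n powr (1/2) / real n powr 2"
    using n by (simp add: divide_right_mono powr_numeral)
  also have "\<dots> = 2 * real n powr (1/2 - 2)"
    by (simp only: powr_diff times_divide_eq_right)
  finally show "norm (ln (real n) / real n ^ 2) \<le> 2 * real n powr - (3/2)"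
    using n by simp
qed

definition zeta2 :: real where "zeta2 = (\<Sum>n. 1 / real n ^ 2)"

text \<open>The constant K of the overview. The 1 pays for ln s \<le> s - 1, the series for the
  change of the \<open>log_excess\<close> terms between exponents 1 and s.\<close>

definition slope :: real where "slope = 1 + 2 * (\<Sum>n. ln (real n) / real n ^ 2)"

lemma slope_nonneg: "0 \<le> slope"
  unfolding slope_def
  by (intro add_nonneg_nonneg mult_nonneg_nonneg suminf_nonneg summable_ln_over_square
      divide_nonneg_nonneg ln_of_nat_nonneg) auto

definition excess_sum :: "nat set \<Rightarrow> real" where
  "excess_sum S = (\<Sum>p\<in>S. log_excess (1 / real p))"

lemma excess_sum_nonneg:
  assumes "\<And>p. p \<in> S \<Longrightarrow> prime p"
  shows "0 \<le> excess_sum S"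
  unfolding excess_sum_def
proof (intro sum_nonneg log_excess_nonneg)
  fix p assume "p \<in> S"
  then show "1 / real p < 1" using prime_gt_1_nat[OF assms, of p] by simp
qed

text \<open>The loss \<open>excess_sum S\<close> has to be exact: it cancels against the sum of the coefficients of
  \<open>cofactor S\<close> below, which is what makes the leading constant of the theorem equal to 1.\<close>

lemma sum_prime_powr_le:
  fixes s :: real
  assumes S: "finite S" "\<And>p. p \<in> S \<Longrightarrow> prime p" and s: "1 < s"
  shows "(\<Sum>p\<in>S. real p powr - s) \<le> - ln (s - 1) - excess_sum S + slope * (s - 1)"
proof -
  let ?x = "\<lambda>p. real p powr - s"
  have p2: "2 \<le> p" if "p \<in> S" for p using S(2)[OF that] prime_ge_2_nat by blast
  have small: "?x p < 1" if "p \<in> S" for p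
    using p2[OF that] s by (simp add: powr_less_one)
  have "(\<Sum>p\<in>S. - ln (1 - ?x p)) = ln (\<Prod>p\<in>S. 1 / (1 - ?x p))"
  proof (subst ln_prod)
    show "(\<Sum>p\<in>S. - ln (1 - ?x p)) = (\<Sum>p\<in>S. ln (1 / (1 - ?x p)))"
      using small by (intro sum.cong) (simp_all add: ln_div less_imp_neq)
  qed (use S(1) small in \<open>auto dest!: small\<close>)
  also have "\<dots> \<le> ln (s / (s - 1))"
  proof (subst ln_le_cancel_iff)
    show "0 < (\<Prod>p\<in>S. 1 / (1 - ?x p))" using small by (intro prod_pos) simp
    show "0 < s / (s - 1)" using s by simp
  qed (rule euler_product_le[OF S s])
  also have "\<dots> = ln s - ln (s - 1)" using s by (simp add: ln_div)
  also have "\<dots> \<le> (s - 1) - ln (s - 1)" using s ln_le_minus_one[of s] by simp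
  finally have 1: "(\<Sum>p\<in>S. - ln (1 - ?x p)) \<le> (s - 1) - ln (s - 1)" .
  have "log_excess (1 / real p) - log_excess (?x p) \<le> 2 * (s - 1) * (ln (real p) / real p ^ 2)"
    if "p \<in> S" for p
  proof -
    note p = p2[OF that]
    \<comment> \<open>This is p powr - (s - 1), so p powr - s = e / p, and 1 - e \<le> (s - 1) ln p
      makes the loss linear in s - 1.\<close>
    define e where "e = exp (- ((s - 1) * ln (real p)))"
    have "?x p = real p powr (- (s - 1) - 1)" by simp
    also have "\<dots> = real p powr (- (s - 1)) / real p"
      using p by (simp only: powr_diff powr_one)
    finally have x: "?x p = e / real p" using p by (simp only: powr_def e_def minus_mult_left) simp
    have "0 \<le> (s - 1) * ln (real p)" using s by (simp add: ln_of_nat_nonneg)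
    then have "e \<le> 1" by (simp add: e_def)
    then have xle: "?x p \<le> 1 / real p"
      unfolding x by (rule divide_right_mono) simp
    have "1 - e \<le> (s - 1) * ln (real p)"
      using exp_ge_add_one_self[of "- ((s - 1) * ln (real p))"] by (simp add: e_def)
    then have d: "1 / real p - ?x p \<le> (s - 1) * ln (real p) / real p"
      unfolding x diff_divide_distrib[symmetric] by (rule divide_right_mono) simp
    have "log_excess (1 / real p) - log_excess (?x p) \<le> 1 / real p * (1 / real p - ?x p) / (1 - 1 / real p)"
      using p xle by (intro log_excess_diff_le) auto
    \<comment> \<open>The bound 1 - 1 / p \<ge> 1 / 2 is the source of the factor 2 in
      \<open>slope\<close>.\<close>
    also have "\<dots> \<le> 1 / real p * (1 / real p - ?x p) / (1 / 2)"
    proof (rule divide_left_mono)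
      show "1 / 2 \<le> 1 - 1 / real p" using p by (simp add: field_simps)
      show "0 \<le> 1 / real p * (1 / real p - ?x p)" using xle by simp
      show "0 < (1 - 1 / real p) * (1 / 2)" using p by simp
    qed
    also have "\<dots> \<le> 1 / real p * ((s - 1) * ln (real p) / real p) / (1 / 2)"
      by (intro divide_right_mono mult_left_mono d) auto
    also have "\<dots> = 2 * (s - 1) * (ln (real p) / real p ^ 2)"
      by (simp add: power2_eq_square)
    finally show ?thesis .
  qed
  then have "excess_sum S - (\<Sum>p\<in>S. log_excess (?x p))
      \<le> (\<Sum>p\<in>S. 2 * (s - 1) * (ln (real p) / real p ^ 2))"
    unfolding excess_sum_def sum_subtractf[symmetric] by (intro sum_mono) auto
  also have "\<dots> \<le> 2 * (s - 1) * (\<Sum>n. ln (real n) / real n ^ 2)"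
    unfolding sum_distrib_left[symmetric]
    using s S(1) by (intro mult_left_mono sum_le_suminf summable_ln_over_square)
      (auto simp: ln_of_nat_nonneg)
  finally have 2: "excess_sum S - (\<Sum>p\<in>S. log_excess (?x p)) \<le> (slope - 1) * (s - 1)"
    by (simp add: slope_def algebra_simps)
  have "(\<Sum>p\<in>S. ?x p) = (\<Sum>p\<in>S. - ln (1 - ?x p)) - (\<Sum>p\<in>S. log_excess (?x p))"
    unfolding sum_subtractf[symmetric] log_excess_def by simp
  with 1 2 show ?thesis by (simp add: algebra_simps)
qed

section \<open>The series \<open>Q(1, X)\<close> and its coefficients\<close>

definition cofactor :: "nat set \<Rightarrow> real fps" where
  "cofactor S = (\<Prod>p\<in>S. fps_derange (1 / real p))"

lemma cofactor_nonneg: "0 \<le> fps_nth (cofactor S) n"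
  unfolding cofactor_def by (intro fps_prod_nonneg fps_derange_nonneg) auto

text \<open>Every prime is at least 2, so r < 2 keeps each r / p below 1 whatever S is.\<close>

lemma cofactor_sums:
  assumes S: "finite S" "\<And>p. p \<in> S \<Longrightarrow> prime p" and r: "0 \<le> r" "r < 2"
  shows "(\<lambda>n. fps_nth (cofactor S) n * r ^ n) sums exp (\<Sum>p\<in>S. log_excess (r / real p))"
proof -
  have small: "r / real p < 1" if "p \<in> S" for p
    using prime_ge_2_nat[OF S(2)[OF that]] r by (simp add: field_simps)
  have "(\<lambda>n. fps_nth (\<Prod>p\<in>S. fps_derange (1 / real p)) n * r ^ n)
      sums (\<Prod>p\<in>S. exp (- (r * (1 / real p))) / (1 - r * (1 / real p)))"
    by (rule fps_prod_sums[OF S(1) r(1) fps_derange_nonneg fps_derange_sums])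
      (use small r in auto)
  moreover have "exp (\<Sum>p\<in>S. log_excess (r / real p))
      = (\<Prod>p\<in>S. exp (- (r * (1 / real p))) / (1 - r * (1 / real p)))"
    using S(1) small by (simp add: exp_sum exp_log_excess)
  ultimately show ?thesis by (simp add: cofactor_def)
qed

lemma sum_cofactor_le:
  assumes S: "finite S" "\<And>p. p \<in> S \<Longrightarrow> prime p"
  shows "(\<Sum>i\<le>k. fps_nth (cofactor S) i) \<le> exp (excess_sum S)"
proof -
  have "(\<lambda>n. fps_nth (cofactor S) n) sums exp (excess_sum S)"
    using cofactor_sums[OF S, of 1] by (simp add: excess_sum_def)
  then show ?thesis
    using sum_le_suminf[of "fps_nth (cofactor S)" "{..k}"] cofactor_nonneg by (simp add: sums_iff)
qed

text \<open>\<open>log_excess (sqrt 2 / real p)\<close> is O(1 / p^2), so the bound is uniform in S.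
  The weights \<open>sqrt 2 ^ i\<close> later become the decay
  \<open>1 / sqrt 2 ^ k\<close>.\<close>

lemma sum_cofactor_sqrt2_le:
  assumes S: "finite S" "\<And>p. p \<in> S \<Longrightarrow> prime p"
  shows "(\<Sum>i\<le>k. fps_nth (cofactor S) i * sqrt 2 ^ i) \<le> exp (8 * zeta2)"
proof -
  have sqrt2: "sqrt 2 \<le> 3 / 2"
    by (rule real_le_lsqrt) (auto simp: power2_eq_square)
  have "log_excess (sqrt 2 / real p) \<le> 8 * (1 / real p ^ 2)" if "p \<in> S" for p
  proof -
    have p: "2 \<le> p" using S(2)[OF that] prime_ge_2_nat by blast
    have le: "sqrt 2 / real p \<le> 3 / 4"
      using p sqrt2 by (simp add: field_simps)
    then have lt: "sqrt 2 / real p < 1" by linarith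
    have "log_excess (sqrt 2 / real p) \<le> sqrt 2 / real p * (sqrt 2 / real p - 0) / (1 - sqrt 2 / real p)"
      using log_excess_diff_le[of 0 "sqrt 2 / real p"] lt by simp
    also have "\<dots> = (2 / real p ^ 2) / (1 - sqrt 2 / real p)"
      by (simp add: power2_eq_square)
    \<comment> \<open>Here sqrt 2 / p \<le> (3 / 2) / 2 = 3 / 4, whence the constant 2 * 4 =
      8.\<close>
    also have "\<dots> \<le> (2 / real p ^ 2) / (1 / 4)"
      using le lt by (intro divide_left_mono) auto
    finally show ?thesis by simp
  qed
  then have "(\<Sum>p\<in>S. log_excess (sqrt 2 / real p)) \<le> 8 * (\<Sum>p\<in>S. 1 / real p ^ 2)"
    unfolding sum_distrib_left by (rule sum_mono)
  also have "\<dots> \<le> 8 * zeta2"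
    unfolding zeta2_def using S(1)
    by (intro mult_left_mono sum_le_suminf summable_inverse_square) auto
  finally have "(\<Sum>p\<in>S. log_excess (sqrt 2 / real p)) \<le> 8 * zeta2" .
  moreover have "(\<lambda>n. fps_nth (cofactor S) n * sqrt 2 ^ n) sums exp (\<Sum>p\<in>S. log_excess (sqrt 2 / real p))"
    using sqrt2 by (intro cofactor_sums[OF S]) auto
  then have "(\<Sum>i\<le>k. fps_nth (cofactor S) i * sqrt 2 ^ i) \<le> exp (\<Sum>p\<in>S. log_excess (sqrt 2 / real p))"
    using sum_le_suminf[of "\<lambda>i. fps_nth (cofactor S) i * sqrt 2 ^ i" "{..k}"] cofactor_nonneg
    by (simp add: sums_iff)
  ultimately show ?thesis by (meson exp_le_cancel_iff order_trans)
qed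

text \<open>The left side is the coefficient of X^k in \<open>exp (P(s) * X) * Q(s, X)\<close>. All
  terms are nonnegative, so P(s) may be raised to B and \<open>Q(s, X)\<close> to
  \<open>Q(1, X)\<close>.\<close>

lemma sum_almost_primes_over_le:
  fixes s :: real
  assumes S: "finite S" "\<And>p. p \<in> S \<Longrightarrow> prime p" and s: "1 \<le> s"
    and B: "(\<Sum>p\<in>S. real p powr - s) \<le> B"
  shows "(\<Sum>n\<in>almost_primes_over S k. real n powr - s)
    \<le> (\<Sum>i\<le>k. B ^ i / fact i * fps_nth (cofactor S) (k - i))"
proof -
  have le: "real p powr - s \<le> 1 / real p" if "p \<in> S" for p
  proof -
    have "real p powr - s \<le> real p powr - 1"
      using prime_ge_1_nat[OF S(2)[OF that]] s by (intro powr_mono) auto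
    then show ?thesis using prime_ge_1_nat[OF S(2)[OF that]] by (simp add: powr_minus_divide)
  qed
  let ?Q = "\<Prod>p\<in>S. fps_derange (real p powr - s)"
  have Q: "0 \<le> fps_nth ?Q j" "fps_nth ?Q j \<le> fps_nth (cofactor S) j" for j
    unfolding cofactor_def
    by (intro fps_prod_nonneg fps_prod_mono fps_derange_nonneg fps_derange_mono le; simp)+
  have P: "0 \<le> (\<Sum>p\<in>S. real p powr - s)" by (intro sum_nonneg) auto
  have "(\<Sum>n\<in>almost_primes_over S k. real n powr - s)
      = (\<Sum>i\<le>k. (\<Sum>p\<in>S. real p powr - s) ^ i / fact i * fps_nth ?Q (k - i))"
    by (subst sum_almost_primes_over[OF S]) (simp_all add: prod_fps_geo fps_mult_nth_le)
  also have "\<dots> \<le> (\<Sum>i\<le>k. B ^ i / fact i * fps_nth (cofactor S) (k - i))"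
    using B P by (intro sum_mono mult_mono divide_right_mono power_mono Q) auto
  finally show ?thesis .
qed

subsection \<open>The bound over a finite set of primes\<close>

text \<open>This is the integral of \<open>n powr - s\<close> over \<open>1 < s \<le> 1 + exp (- c)\<close>, after the substitution
  \<open>s = 1 + exp (- c - v)\<close>.\<close>

lemma has_bochner_integral_powr_substituted:
  fixes n :: nat and c :: real
  assumes n: "2 \<le> n"
  shows "has_bochner_integral lborel
    (\<lambda>v. indicator {0..} v * (real n powr - (1 + exp (- c - v)) * exp (- c - v)))
    ((1 / real n - real n powr - (1 + exp (- c))) / ln (real n))"
proof (rule has_bochner_integral_nn_integral)
  let ?f = "\<lambda>v. real n powr - (1 + exp (- c - v)) * exp (- c - v)"
  let ?F = "\<lambda>v. real n powr - (1 + exp (- c - v)) / ln (real n)"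
  have ln: "0 < ln (real n)" using n by simp
  have "((\<lambda>v::real. exp (- v)) \<longlongrightarrow> 0) at_top"
    by (rule filterlim_compose[OF exp_at_bot filterlim_uminus_at_bot_at_top])
  then have "((\<lambda>v::real. exp (- c) * exp (- v)) \<longlongrightarrow> 0) at_top"
    by (rule tendsto_mult_right_zero)
  then have tendsto: "((\<lambda>v::real. exp (- c - v)) \<longlongrightarrow> 0) at_top"
    by (simp flip: exp_add)
  have "((\<lambda>v. real n powr - (1 + exp (- c - v)) / ln (real n)) \<longlongrightarrow> real n powr - (1 + 0) / ln (real n)) at_top"
    using n ln by (intro tendsto_intros tendsto) auto
  then have lim: "(?F \<longlongrightarrow> 1 / real n / ln (real n)) at_top"
    using n by (simp add: powr_minus_divide)
  have "(\<integral>\<^sup>+v. ennreal (?f v) * indicator {0..} v \<partial>lborel)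
      = ennreal (1 / real n / ln (real n) - ?F 0)"
  proof (rule nn_integral_FTC_atLeast)
    show "?f \<in> borel_measurable borel" by measurable
    show "DERIV ?F v :> ?f v" for v
      using n ln by (auto intro!: derivative_eq_intros simp: field_simps)
    show "0 \<le> ?f v" for v by simp
  qed (rule lim)
  then show "(\<integral>\<^sup>+v. ennreal (indicator {0..} v * ?f v) \<partial>lborel)
      = ennreal ((1 / real n - real n powr - (1 + exp (- c))) / ln (real n))"
    by (simp add: diff_divide_distrib ennreal_mult' mult.commute ennreal_indicator)
  have "real n powr - (1 + exp (- c)) \<le> real n powr - 1"
    using n by (intro powr_mono) auto
  then show "0 \<le> (1 / real n - real n powr - (1 + exp (- c))) / ln (real n)"
    using n ln by (simp add: powr_minus_divide)
qed (auto intro!: AE_I2)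

section \<open>Gamma integrals\<close>

lemma has_bochner_integral_erlang:
  fixes l :: real
  assumes l: "0 < l"
  shows "has_bochner_integral lborel (\<lambda>v. indicator {0..} v * (v ^ i / fact i * exp (- l * v))) (1 / l ^ Suc i)"
proof -
  have "has_bochner_integral lborel (erlang_density i l) 1"
    using nn_integral_erlang_ith_moment[OF l, of i 0] l
    by (intro has_bochner_integral_nn_integral) auto
  then have "has_bochner_integral lborel (\<lambda>v. erlang_density i l v / l ^ Suc i) (1 / l ^ Suc i)"
    by (rule has_bochner_integral_divide_zero)
  moreover have "(\<lambda>v. erlang_density i l v / l ^ Suc i)
      = (\<lambda>v. indicator {0..} v * (v ^ i / fact i * exp (- l * v)))"
    using l by (auto simp: erlang_density_def fun_eq_iff indicator_def)
  ultimately show ?thesis by simp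
qed

lemma add_power_over_fact:
  "(a + b :: real) ^ i / fact i = (\<Sum>m\<le>i. (a ^ m / fact m) * (b ^ (i - m) / fact (i - m)))"
  using arg_cong[OF fps_exp_add_mult[of a b], of "\<lambda>F. fps_nth F i"]
  by (simp add: fps_mult_nth_le)

lemma sum_rev_atMost:
  fixes f :: "nat \<Rightarrow> 'a::comm_monoid_add"
  shows "(\<Sum>i\<le>k. f (k - i)) = (\<Sum>i\<le>k. f i)"
  by (rule sum.reindex_bij_witness[of _ "\<lambda>i. k - i" "\<lambda>i. k - i"]) auto

text \<open>Binomial expansion attaches exp (- (m + 1) v) to K^m, so each term is a Gamma integral.
  The term m = 0 is exactly 1; the others add up to O(2^-i).\<close>

lemma shifted_gamma_integral:
  fixes K :: real
  assumes K: "0 \<le> K"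
  obtains J where "has_bochner_integral lborel
      (\<lambda>v. indicator {0..} v * ((v + K * exp (- v)) ^ i / fact i * exp (- v))) J"
    and "J \<le> 1 + exp (2 * K) / 2 ^ i"
proof
  let ?J = "\<lambda>m. K ^ m / fact m * (1 / (real m + 1) ^ Suc (i - m))"
  have "has_bochner_integral lborel (\<lambda>v. \<Sum>m\<le>i. K ^ m / fact m *
      (indicator {0..} v * (v ^ (i - m) / fact (i - m) * exp (- (real m + 1) * v)))) (\<Sum>m\<le>i. ?J m)"
    by (intro has_bochner_integral_sum has_bochner_integral_mult_right has_bochner_integral_erlang) auto
  moreover have "(\<Sum>m\<le>i. K ^ m / fact m *
      (indicator {0..} v * (v ^ (i - m) / fact (i - m) * exp (- (real m + 1) * v))))
      = indicator {0..} v * ((v + K * exp (- v)) ^ i / fact i * exp (- v))" for v :: real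
  proof -
    have "exp (- (real m + 1) * v) = exp (- v) ^ m * exp (- v)" for m
      by (simp flip: exp_of_nat_mult exp_add add: algebra_simps)
    then show ?thesis
      unfolding add.commute[of v] add_power_over_fact sum_distrib_left sum_distrib_right
      by (intro sum.cong) (simp_all add: power_mult_distrib mult_ac)
  qed
  ultimately show "has_bochner_integral lborel
      (\<lambda>v. indicator {0..} v * ((v + K * exp (- v)) ^ i / fact i * exp (- v))) (\<Sum>m\<le>i. ?J m)"
    by simp
  \<comment> \<open>Since m + 1 \<ge> 2, the Gamma factor is at most 2^m / 2^i; the 2^m joins K^m
    and leads to the exponential series at 2 K.\<close>
  have le: "?J m \<le> (2 * K) ^ m / fact m * (1 / 2 ^ i)" if m: "m \<in> {1..i}" for m
  proof -
    have "(2::real) ^ i \<le> 2 ^ m * (real m + 1) ^ Suc (i - m)"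
    proof -
      have "(2::real) ^ i = 2 ^ m * 2 ^ (i - m)" using m by (simp flip: power_add)
      also have "\<dots> \<le> 2 ^ m * (real m + 1) ^ (i - m)"
        using m by (intro mult_left_mono power_mono) auto
      also have "\<dots> \<le> 2 ^ m * (real m + 1) ^ Suc (i - m)"
        by (intro mult_left_mono power_increasing) auto
      finally show ?thesis .
    qed
    then have "1 / (real m + 1) ^ Suc (i - m) \<le> 2 ^ m * (1 / 2 ^ i)"
      by (simp add: pos_divide_le_eq pos_le_divide_eq del: power_Suc)
    then have "?J m \<le> K ^ m / fact m * (2 ^ m * (1 / 2 ^ i))"
      using K by (intro mult_left_mono) auto
    then show ?thesis by (simp add: power_mult_distrib mult_ac)
  qed
  have "(\<Sum>m\<le>i. ?J m) = 1 + (\<Sum>m=1..i. ?J m)"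
  proof -
    have "{..i} = insert 0 {1..i}" by auto
    then show ?thesis by simp
  qed
  also have "(\<Sum>m=1..i. ?J m) \<le> (\<Sum>m=1..i. (2 * K) ^ m / fact m * (1 / 2 ^ i))"
    by (rule sum_mono) (rule le)
  also have "\<dots> = (\<Sum>m=1..i. (2 * K) ^ m / fact m) * (1 / 2 ^ i)"
    by (rule sum_distrib_right[symmetric])
  also have "(\<Sum>m=1..i. (2 * K) ^ m / fact m) \<le> exp (2 * K)"
    using sum_le_suminf[of "\<lambda>m. (2 * K) ^ m / fact m" "{1..i}"] exp_converges[of "2 * K"] K
    by (simp add: sums_iff field_simps)
  finally show "(\<Sum>m\<le>i. ?J m) \<le> 1 + exp (2 * K) / 2 ^ i" by (simp add: divide_right_mono)
qed

text \<open>In the last factor, 1 accounts for s up to 1 + exp (- c) and 1 / ln 2 for larger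
  s.\<close>

definition remainder_const :: real where
  "remainder_const = exp (2 * slope) * exp (8 * zeta2) * (1 + 1 / ln 2)"

text \<open>The integral of n powr - s over s > 1 is cut at 1 + exp (- c): the lower range yields 1
  plus an error, the upper range only an error.\<close>

lemma sum_erdos_almost_primes_over_le:
  assumes S: "finite S" "\<And>p. p \<in> S \<Longrightarrow> prime p" and k: "1 \<le> k"
  shows "(\<Sum>n\<in>almost_primes_over S k. 1 / (real n * ln (real n))) \<le> 1 + remainder_const / sqrt 2 ^ k"
proof -
  define c where "c = excess_sum S"
  have c: "0 \<le> c" unfolding c_def by (rule excess_sum_nonneg[OF S(2)])
  define A where "A = almost_primes_over S k"
  have finA: "finite A" unfolding A_def by (rule finite_almost_primes_over[OF S])
  have n2: "2 \<le> n" if "n \<in> A" for n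
    using that almost_primes_ge_2[OF k] by (simp add: A_def almost_primes_over_def)
  define q where "q = (\<lambda>i. fps_nth (cofactor S) (k - i))"
  have q: "0 \<le> q i" for i by (simp add: q_def cofactor_nonneg)
  define K where "K = slope"
  have K: "0 \<le> K" by (simp add: K_def slope_nonneg)
  \<comment> \<open>For s = 1 + exp (- c - v), - ln (s - 1) = c + v, so c cancels; c \<ge> 0 then
    removes exp (- c) from the error.\<close>
  have prime_sum: "(\<Sum>p\<in>S. real p powr - (1 + exp (- c - v))) \<le> v + K * exp (- v)" if "0 \<le> v" for v
  proof -
    have "(\<Sum>p\<in>S. real p powr - (1 + exp (- c - v))) \<le> - ln (exp (- c - v)) - c + K * exp (- c - v)"
      using sum_prime_powr_le[OF S, of "1 + exp (- c - v)"] by (simp add: c_def K_def)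
    also have "K * exp (- c - v) \<le> K * exp (- v)"
      using K c by (intro mult_left_mono) auto
    finally show ?thesis by simp
  qed
  have zeta_le: "(\<Sum>n\<in>A. real n powr - (1 + exp (- c - v)))
      \<le> (\<Sum>i\<le>k. (v + K * exp (- v)) ^ i / fact i * q i)" if "0 \<le> v" for v
    unfolding A_def q_def by (rule sum_almost_primes_over_le[OF S]) (use prime_sum[OF that] in auto)

  have "\<forall>i. \<exists>J. has_bochner_integral lborel
      (\<lambda>v. indicator {0..} v * ((v + K * exp (- v)) ^ i / fact i * exp (- v))) J
      \<and> J \<le> 1 + exp (2 * K) / 2 ^ i"
    using shifted_gamma_integral[OF K] by blast
  from choice[OF this] obtain J where J: "has_bochner_integral lborel
      (\<lambda>v. indicator {0..} v * ((v + K * exp (- v)) ^ i / fact i * exp (- v))) (J i)"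
      "J i \<le> 1 + exp (2 * K) / 2 ^ i" for i
    by blast

  have "has_bochner_integral lborel
      (\<lambda>v. \<Sum>n\<in>A. indicator {0..} v * (real n powr - (1 + exp (- c - v)) * exp (- c - v)))
      (\<Sum>n\<in>A. (1 / real n - real n powr - (1 + exp (- c))) / ln (real n))"
    by (intro has_bochner_integral_sum has_bochner_integral_powr_substituted n2)
  moreover have "has_bochner_integral lborel
      (\<lambda>v. \<Sum>i\<le>k. exp (- c) * q i * (indicator {0..} v * ((v + K * exp (- v)) ^ i / fact i * exp (- v))))
      (\<Sum>i\<le>k. exp (- c) * q i * J i)"
    by (intro has_bochner_integral_sum has_bochner_integral_mult_right J)
  \<comment> \<open>Of the Jacobian exp (- c - v), exp (- v) enters the Gamma integral and exp (- c)
    stays outside for the coefficient sum.\<close>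
  moreover have "(\<Sum>n\<in>A. indicator {0..} v * (real n powr - (1 + exp (- c - v)) * exp (- c - v)))
      \<le> (\<Sum>i\<le>k. exp (- c) * q i * (indicator {0..} v * ((v + K * exp (- v)) ^ i / fact i * exp (- v))))" for v
  proof (cases "0 \<le> v")
    case True
    have "(\<Sum>n\<in>A. real n powr - (1 + exp (- c - v))) * exp (- c - v)
        \<le> (\<Sum>i\<le>k. (v + K * exp (- v)) ^ i / fact i * q i) * (exp (- c) * exp (- v))"
      using zeta_le[OF True] by (simp add: exp_diff exp_minus divide_right_mono field_simps)
    then show ?thesis
      using True by (simp add: sum_distrib_left sum_distrib_right mult_ac)
  qed simp
  ultimately have main: "(\<Sum>n\<in>A. (1 / real n - real n powr - (1 + exp (- c))) / ln (real n))
      \<le> (\<Sum>i\<le>k. exp (- c) * q i * J i)"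
    by (metis (no_types, lifting) has_bochner_integral_integral_eq has_bochner_integral_iff integral_mono)

  \<comment> \<open>As q reverses the coefficients, factoring out 1 / sqrt 2 ^ k leaves the weighted
    sum already bounded.\<close>
  have "sqrt 2 ^ k * (\<Sum>i\<le>k. q i / sqrt 2 ^ i) = (\<Sum>i\<le>k. fps_nth (cofactor S) i * sqrt 2 ^ i)"
  proof -
    have "sqrt 2 ^ k * (\<Sum>i\<le>k. q i / sqrt 2 ^ i) = (\<Sum>i\<le>k. fps_nth (cofactor S) (k - i) * sqrt 2 ^ (k - i))"
      unfolding sum_distrib_left q_def
      by (intro sum.cong) (simp_all add: power_diff field_simps)
    also have "\<dots> = (\<Sum>i\<le>k. fps_nth (cofactor S) i * sqrt 2 ^ i)"
      by (rule sum_rev_atMost)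
    finally show ?thesis .
  qed
  with sum_cofactor_sqrt2_le[OF S, of k]
  have decay: "(\<Sum>i\<le>k. q i / sqrt 2 ^ i) \<le> exp (8 * zeta2) / sqrt 2 ^ k"
    by (simp add: pos_le_divide_eq mult.commute)

  have "(\<Sum>i\<le>k. exp (- c) * q i * J i) \<le> (\<Sum>i\<le>k. exp (- c) * q i + exp (2 * K) * (q i / sqrt 2 ^ i))"
  proof (rule sum_mono)
    fix i
    \<comment> \<open>The decay 2^-i is weakened to the rate sqrt 2 at which the cofactor is
      controlled.\<close>
    have "sqrt 2 ^ i \<le> (2 :: real) ^ i"
      by (intro power_mono real_le_lsqrt) auto
    then have "exp (2 * K) / 2 ^ i \<le> exp (2 * K) / sqrt 2 ^ i"
      by (intro divide_left_mono) auto
    then have "exp (- c) * q i * J i \<le> exp (- c) * q i * (1 + exp (2 * K) / sqrt 2 ^ i)"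
      using J(2)[of i] q[of i] by (intro mult_left_mono) auto
    also have "\<dots> = exp (- c) * q i + exp (- c) * (exp (2 * K) * (q i / sqrt 2 ^ i))"
      by (simp add: algebra_simps)
    also have "exp (- c) * (exp (2 * K) * (q i / sqrt 2 ^ i)) \<le> 1 * (exp (2 * K) * (q i / sqrt 2 ^ i))"
      using c q[of i] by (intro mult_right_mono) auto
    finally show "exp (- c) * q i * J i \<le> exp (- c) * q i + exp (2 * K) * (q i / sqrt 2 ^ i)" by simp
  qed
  also have "\<dots> = exp (- c) * (\<Sum>i\<le>k. q i) + exp (2 * K) * (\<Sum>i\<le>k. q i / sqrt 2 ^ i)"
    by (simp add: sum.distrib sum_distrib_left)
  also have "(\<Sum>i\<le>k. q i) = (\<Sum>i\<le>k. fps_nth (cofactor S) i)"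
    unfolding q_def by (rule sum_rev_atMost)
  \<comment> \<open>The coefficient sum is at most exp c, which exp (- c) cancels: the leading
    1.\<close>
  also have "exp (- c) * \<dots> \<le> exp (- c) * exp c"
    unfolding c_def by (intro mult_left_mono sum_cofactor_le[OF S]) auto
  also have "exp (- c) * exp c = 1" by (simp flip: exp_add)
  also have "exp (2 * K) * (\<Sum>i\<le>k. q i / sqrt 2 ^ i) \<le> exp (2 * K) * (exp (8 * zeta2) / sqrt 2 ^ k)"
    by (intro mult_left_mono decay) auto
  finally have first: "(\<Sum>n\<in>A. (1 / real n - real n powr - (1 + exp (- c))) / ln (real n))
      \<le> 1 + exp (2 * K) * exp (8 * zeta2) / sqrt 2 ^ k"
    using main by simp

  \<comment> \<open>These terms are the integrals over s > 1 + exp (- c). At the cut v = 0, so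
    \<open>zeta_le\<close> involves powers of K alone.\<close>
  have "(\<Sum>n\<in>A. real n powr - (1 + exp (- c)) / ln (real n)) \<le> (\<Sum>n\<in>A. real n powr - (1 + exp (- c)) / ln 2)"
    using n2 by (intro sum_mono divide_left_mono) fastforce+
  also have "\<dots> = (\<Sum>n\<in>A. real n powr - (1 + exp (- c))) / ln 2"
    by (simp add: sum_divide_distrib)
  also have "\<dots> \<le> (\<Sum>i\<le>k. K ^ i / fact i * q i) / ln 2"
    using zeta_le[of 0] by (intro divide_right_mono) auto
  also have "(\<Sum>i\<le>k. K ^ i / fact i * q i) \<le> (\<Sum>i\<le>k. exp (2 * K) * (q i / sqrt 2 ^ i))"
  proof (rule sum_mono)
    fix i
    have "(K * sqrt 2) ^ i / fact i \<le> exp (K * sqrt 2)"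
      using sum_le_suminf[of "\<lambda>m. (K * sqrt 2) ^ m / fact m" "{i}"] exp_converges[of "K * sqrt 2"] K
      by (simp add: sums_iff field_simps)
    also have "\<dots> \<le> exp (2 * K)"
      using K mult_left_mono[of "sqrt 2" 2 K] by (simp add: real_le_lsqrt mult.commute)
    finally have "K ^ i / fact i \<le> exp (2 * K) / sqrt 2 ^ i"
      by (simp add: power_mult_distrib field_simps)
    then show "K ^ i / fact i * q i \<le> exp (2 * K) * (q i / sqrt 2 ^ i)"
      using mult_right_mono[OF _ q[of i]] by fastforce
  qed
  also have "\<dots> = exp (2 * K) * (\<Sum>i\<le>k. q i / sqrt 2 ^ i)" by (simp add: sum_distrib_left)
  also have "\<dots> \<le> exp (2 * K) * (exp (8 * zeta2) / sqrt 2 ^ k)"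
    by (intro mult_left_mono decay) auto
  finally have second: "(\<Sum>n\<in>A. real n powr - (1 + exp (- c)) / ln (real n))
      \<le> exp (2 * K) * exp (8 * zeta2) / ln 2 / sqrt 2 ^ k"
    by (simp add: divide_right_mono mult_ac)

  have "(\<Sum>n\<in>A. 1 / (real n * ln (real n)))
      = (\<Sum>n\<in>A. (1 / real n - real n powr - (1 + exp (- c))) / ln (real n))
      + (\<Sum>n\<in>A. real n powr - (1 + exp (- c)) / ln (real n))"
    unfolding sum.distrib[symmetric] by (intro sum.cong) (auto simp: diff_divide_distrib)
  with first second show ?thesis
    by (simp add: A_def K_def remainder_const_def algebra_simps add_divide_distrib)
qed

subsection \<open>Passage to all almost primes\<close>

text \<open>Finitely many n involve finitely many primes, and the bound does not depend on that
  set.\<close>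

lemma sum_erdos_le:
  assumes k: "1 \<le> k" and F: "finite F" "F \<subseteq> almost_primes k"
  shows "(\<Sum>n\<in>F. 1 / (real n * ln (real n))) \<le> 1 + remainder_const / sqrt 2 ^ k"
proof -
  let ?S = "\<Union>n\<in>F. prime_factors n"
  have S: "finite ?S" "\<And>p. p \<in> ?S \<Longrightarrow> prime p" using F(1) by auto
  have "F \<subseteq> almost_primes_over ?S k"
    using F(2) by (auto simp: almost_primes_over_def)
  then have "(\<Sum>n\<in>F. 1 / (real n * ln (real n)))
      \<le> (\<Sum>n\<in>almost_primes_over ?S k. 1 / (real n * ln (real n)))"
    using finite_almost_primes_over[OF S]
    by (intro sum_mono2) (auto simp: ln_of_nat_nonneg)
  also have "\<dots> \<le> 1 + remainder_const / sqrt 2 ^ k"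
    by (rule sum_erdos_almost_primes_over_le[OF S k])
  finally show ?thesis .
qed

lemma summable_on_erdos:
  assumes k: "1 \<le> k"
  shows "(\<lambda>n. 1 / (real n * ln (real n))) summable_on almost_primes k"
  by (rule nonneg_bdd_above_summable_on)
    (auto simp: ln_of_nat_nonneg intro!: bdd_aboveI2 sum_erdos_le[OF k])

lemma erdos_sum_le:
  assumes k: "1 \<le> k"
  shows "erdos_sum (almost_primes k) \<le> 1 + remainder_const / sqrt 2 ^ k"
  unfolding erdos_sum_def
  by (intro infsum_le_finite_sums summable_on_erdos sum_erdos_le k)

lemma summable_on_powr:
  fixes s :: real
  assumes s: "1 < s"
  shows "(\<lambda>n. real n powr - s) summable_on almost_primes k"
proof (rule nonneg_bdd_above_summable_on)
  show "bdd_above (sum (\<lambda>n. real n powr - s) ` {F. F \<subseteq> almost_primes k \<and> finite F})"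
    using s by (intro bdd_aboveI2[where M = "s / (s - 1)"] sum_powr_le)
      (auto simp: almost_primes_def)
qed simp

section \<open>The integral formula\<close>

lemma infsum_imp_sums:
  fixes f :: "nat \<Rightarrow> real"
  assumes "f summable_on A"
  shows "(\<lambda>n. indicator A n * f n) sums infsum f A"
proof -
  have "((\<lambda>n. indicator A n * f n) has_sum infsum f A) UNIV"
    by (rule has_sum_cong_neutral[THEN iffD1, OF _ _ _ has_sum_infsum[OF assms]]) auto
  then show ?thesis by (rule has_sum_imp_sums)
qed

lemma has_bochner_integral_powr_minus:
  fixes n :: nat
  assumes n: "2 \<le> n"
  shows "has_bochner_integral lborel (\<lambda>s. indicator {1<..} s * real n powr - s) (1 / (real n * ln (real n)))"
proof (rule has_bochner_integral_nn_integral)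
  have ln: "0 < ln (real n)" using n by simp
  have "((\<lambda>s. exp (- (s * ln (real n)))) \<longlongrightarrow> 0) at_top"
    by (intro filterlim_compose[OF exp_at_bot] filterlim_compose[OF filterlim_uminus_at_bot_at_top]
        filterlim_at_top_mult_tendsto_pos[OF tendsto_const ln] filterlim_ident)
  then have "((\<lambda>s. - (real n powr - s / ln (real n))) \<longlongrightarrow> - (0 / ln (real n))) at_top"
    using n ln by (intro tendsto_intros) (auto simp: powr_def)
  then have lim: "((\<lambda>s. - (real n powr - s / ln (real n))) \<longlongrightarrow> 0) at_top" by simp
  have "(\<integral>\<^sup>+s. ennreal (real n powr - s) * indicator {1..} s \<partial>lborel)
      = ennreal (0 - - (real n powr - 1 / ln (real n)))"
  proof (rule nn_integral_FTC_atLeast)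
    show "((\<lambda>s. - (real n powr - s / ln (real n))) has_real_derivative real n powr - s) (at s)" for s
      using n ln by (auto intro!: derivative_eq_intros)
  qed (use lim in auto)
  also have "0 - - (real n powr - 1 / ln (real n)) = 1 / (real n * ln (real n))"
    using n by (simp add: powr_minus_divide)
  finally have "(\<integral>\<^sup>+s. ennreal (real n powr - s) * indicator {1..} s \<partial>lborel) = ennreal (1 / (real n * ln (real n)))" .
  \<comment> \<open>The endpoint 1 is a null set.\<close>
  moreover have "(\<integral>\<^sup>+s. ennreal (indicator {1<..} s * real n powr - s) \<partial>lborel)
      = (\<integral>\<^sup>+s. ennreal (real n powr - s) * indicator {1..} s \<partial>lborel)"
    using AE_lborel_singleton[of "1::real"]
    by (intro nn_integral_cong_AE) (auto simp: indicator_def)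
  ultimately show "(\<integral>\<^sup>+s. ennreal (indicator {1<..} s * real n powr - s) \<partial>lborel)
      = ennreal (1 / (real n * ln (real n)))" by simp
  show "0 \<le> 1 / (real n * ln (real n))" using ln by simp
qed (auto intro!: AE_I2)

text \<open>Termwise integration of nonnegative functions, justified because their integrals sum to
  the convergent Erdos sum. As k \<ge> 1, n = 1 is excluded, whose constant term is not
  integrable.\<close>

lemma almost_prime_zeta_integral:
  assumes k: "1 \<le> k"
  shows "has_bochner_integral lborel (\<lambda>s. indicator {1<..} s * almost_prime_zeta k s)
    (erdos_sum (almost_primes k))"
proof -
  let ?A = "almost_primes k"
  let ?f = "\<lambda>n s. indicator ?A n * (indicator {1<..} s * real n powr - s)"
  have f: "has_bochner_integral lborel (?f n) (indicator ?A n * (1 / (real n * ln (real n))))" for n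
    using has_bochner_integral_powr_minus[of n] almost_primes_ge_2[OF k, of n]
    by (intro has_bochner_integral_mult_right) (auto simp: indicator_def)
  \<comment> \<open>For s \<le> 1 the indicator makes both sides zero, so the default of
    \<open>infsum\<close> never enters.\<close>
  have sums: "(\<lambda>n. ?f n s) sums (indicator {1<..} s * almost_prime_zeta k s)" for s
  proof (cases "1 < s")
    case True
    then show ?thesis
      using infsum_imp_sums[OF summable_on_powr[OF True]] by (simp add: almost_prime_zeta_def)
  qed simp
  have erdos: "(\<lambda>n. indicator ?A n * (1 / (real n * ln (real n)))) sums erdos_sum ?A"
    using infsum_imp_sums[OF summable_on_erdos[OF k]] by (simp add: erdos_sum_def)
  have 1: "integrable lborel (?f n)" for n
    using f by (simp add: has_bochner_integral_iff)
  have 2: "AE s in lborel. summable (\<lambda>n. norm (?f n s))"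
    using sums by (intro AE_I2) (simp add: abs_mult sums_iff)
  have norm: "norm (?f n s) = ?f n s" for n s by (simp add: abs_mult)
  have 3: "summable (\<lambda>n. \<integral>s. norm (?f n s) \<partial>lborel)"
    unfolding norm has_bochner_integral_integral_eq[OF f] using erdos by (rule sums_summable)
  have suminf: "(\<lambda>s. \<Sum>n. ?f n s) = (\<lambda>s. indicator {1<..} s * almost_prime_zeta k s)"
    using sums by (simp add: sums_iff)
  show ?thesis
    unfolding has_bochner_integral_iff
    using integrable_suminf[OF 1 2 3] integral_suminf[OF 1 2 3] erdos
    unfolding suminf has_bochner_integral_integral_eq[OF f] by (simp add: sums_iff)
qed

theorem theorem5p3:
  shows "(\<forall>k\<ge>1.
            (\<lambda>n. 1 / (real n * ln (real n))) summable_on almost_primes k \<and>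
            (\<forall>s>1. (\<lambda>n. real n powr (- s)) summable_on almost_primes k) \<and>
            set_integrable lborel {1<..} (almost_prime_zeta k) \<and>
            erdos_sum (almost_primes k) = (LINT s:{1<..}|lborel. almost_prime_zeta k s)) \<and>
         (\<exists>C>0. \<forall>k\<ge>1.
            erdos_sum (almost_primes k) \<le> 1 + C * real k * 2 powr (- (real k / 2)))"
proof (intro conjI allI impI exI)
  fix k :: nat assume k: "1 \<le> k"
  show "(\<lambda>n. 1 / (real n * ln (real n))) summable_on almost_primes k"
    by (rule summable_on_erdos[OF k])
  show "(\<lambda>n. real n powr (- s)) summable_on almost_primes k" if "1 < s" for s
    by (rule summable_on_powr[OF that])
  show "set_integrable lborel {1<..} (almost_prime_zeta k)"
    using almost_prime_zeta_integral[OF k] by (simp add: set_integrable_def has_bochner_integral_iff)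
  show "erdos_sum (almost_primes k) = (LINT s:{1<..}|lborel. almost_prime_zeta k s)"
    using almost_prime_zeta_integral[OF k]
    by (simp add: set_lebesgue_integral_def has_bochner_integral_iff)
next
  show pos: "0 < remainder_const" by (simp add: remainder_const_def add_pos_pos)
  fix k :: nat assume k: "1 \<le> k"
  have eq: "1 / sqrt 2 ^ k = 2 powr (- (real k / 2))"
    by (simp add: powr_minus_divide flip: powr_half_sqrt powr_realpow) (simp add: powr_powr)
  have "erdos_sum (almost_primes k) \<le> 1 + remainder_const / sqrt 2 ^ k"
    by (rule erdos_sum_le[OF k])
  also have "\<dots> = 1 + remainder_const * 1 * 2 powr (- (real k / 2))"
    unfolding eq[symmetric] by simp
  \<comment> \<open>The factor k \<ge> 1 only enlarges the error.\<close>
  also have "\<dots> \<le> 1 + remainder_const * real k * 2 powr (- (real k / 2))"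
    using k pos by (intro add_left_mono mult_right_mono mult_left_mono) auto
  finally show "erdos_sum (almost_primes k) \<le> 1 + remainder_const * real k * 2 powr (- (real k / 2))" .
qed

end
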